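(* Let $x\in[0,1]^n$ and for each $B\subseteq[n]$ let $p(B)=\prod_{i\in B}x_i\prod_{j\notin B}(1-x_j)$. For each $B\subseteq[n]$ let $q_B$ be a probability distribution on the subsets of $B$ (so $q_B(A)\ge0$ and $\sum_{A\subseteq B}q_B(A)=1$). Let $\beta\ge 0$ and suppose: (Marginal property) for all $i\in[n]$, $\sum_{B\subseteq[n]}p(B)\sum_{A\subseteq B:\,i\in A}q_B(A)\ \ge\ \beta\sum_{B\subseteq[n]:\,i\in B}p(B)$; (Monotonicity) for all $B\subseteq B'\subseteq[n]$ and all $i\in B$, $\sum_{A\subseteq B:\,i\in A}q_B(A)\ \ge\ \sum_{A'\subseteq B':\,i\in A'}q_{B'}(A')$. Then for every monotone submodular function $f:2^{[n]}\to\mathbb{R}_+$, $\sum_{B\subseteq[n]}p(B)\sum_{A\subseteq B}q_B(A)f(A)\ \ge\ \beta\sum_{B\subseteq[n]}p(B)f(B)$.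
   Formalization: When x = 0 the formal theorem additionally assumes β ≤ 1 or f(∅) = 0; without this the claim fails (n = 1, x = 0, β = 2, q_B the point mass at ∅, f ≡ 1), and no true instance is excluded. *)

theory Defs
  imports Complex_Main
begin

definition indep_prob :: "nat \<Rightarrow> (nat \<Rightarrow> real) \<Rightarrow> nat set \<Rightarrow> real" where
  "indep_prob n x B = (\<Prod>i\<in>B. x i) * (\<Prod>j\<in>{1..n} - B. 1 - x j)"

definition monotone_setfun_on :: "'a set \<Rightarrow> ('a set \<Rightarrow> real) \<Rightarrow> bool" where
  "monotone_setfun_on E f \<longleftrightarrow> (\<forall>S T. S \<subseteq> T \<longrightarrow> T \<subseteq> E \<longrightarrow> f S \<le> f T)"

definition submodular_on :: "'a set \<Rightarrow> ('a set \<Rightarrow> real) \<Rightarrow> bool" where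
  "submodular_on E f \<longleftrightarrow>
     (\<forall>S T. S \<subseteq> E \<longrightarrow> T \<subseteq> E \<longrightarrow> f (S \<union> T) + f (S \<inter> T) \<le> f S + f T)"

text \<open>
  If all \<open>x i\<close> with \<open>i \<in> {1..n}\<close> vanish, only the empty set has positive probability. The marginal
  property then holds for every \<open>\<beta>\<close>, and the inequality
  \<open>\<beta> * (\<Sum>B. p B * f B) \<le> (\<Sum>B. p B * (\<Sum>A. q B A * f A))\<close>
  reads \<open>\<beta> * f {} \<le> f {}\<close>, which fails exactly when \<open>\<beta> > 1\<close> and \<open>f {} > 0\<close>. If some \<open>x i\<close> is
  positive, the marginal property itself forces \<open>\<beta> \<le> 1\<close>.
\<close>

end

theory Submission
  imports Defs
begin

text \<open>
  Adding the elements of \<open>A \<subseteq> B\<close> in increasing order and replacing, by submodularity, each marginal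
  gain over an initial part of \<open>A\<close> by the gain over the same initial part of \<open>B\<close> gives
  \<open>f A \<ge> f {} + (\<Sum>i\<in>A. g\<^sub>i B)\<close>, with equality for \<open>A = B\<close>. Averaging over \<open>A\<close> turns the sum
  into \<open>\<Sum>i. m\<^sub>i B * g\<^sub>i B\<close>, where \<open>m\<^sub>i B\<close> is the probability that \<open>i\<close> is selected from \<open>B\<close>.
  Conditioned on \<open>i \<in> B\<close> both factors are decreasing in \<open>B\<close>, so by the Harris inequality they are
  positively correlated, and the marginal property bounds the mean of \<open>m\<^sub>i\<close> from below by \<open>\<beta>\<close>.
\<close>

text \<open>The ground set is a parameter so that single elements can be split off: the Harris
  induction adds one, and conditioning on \<open>i\<close> being present removes \<open>i\<close>
  from \<open>{1..n}\<close>.\<close>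

definition indep_expect :: "'a set \<Rightarrow> ('a \<Rightarrow> real) \<Rightarrow> ('a set \<Rightarrow> real) \<Rightarrow> real" where
  "indep_expect S x h = (\<Sum>B\<in>Pow S. (\<Prod>i\<in>B. x i) * (\<Prod>j\<in>S - B. 1 - x j) * h B)"

lemma indep_expect_insert:
  assumes "finite S" "a \<notin> S"
  shows "indep_expect (insert a S) x h =
    x a * indep_expect S x (\<lambda>B. h (insert a B)) + (1 - x a) * indep_expect S x h"
proof -
  let ?w = "\<lambda>B. (\<Prod>i\<in>B. x i) * (\<Prod>j\<in>insert a S - B. 1 - x j)"
  have fin: "finite B" if "B \<in> Pow S" for B
    using that assms(1) finite_subset by auto
  have inj: "inj_on (insert a) (Pow S)"
    using assms(2) by (auto simp: inj_on_def)
  have "indep_expect (insert a S) x h =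
      (\<Sum>B\<in>Pow S. ?w B * h B) + (\<Sum>B\<in>insert a ` Pow S. ?w B * h B)"
    unfolding indep_expect_def Pow_insert
    using assms by (intro sum.union_disjoint) auto
  also have "(\<Sum>B\<in>Pow S. ?w B * h B) = (1 - x a) * indep_expect S x h"
    unfolding indep_expect_def sum_distrib_left
  proof (intro sum.cong refl)
    fix B assume B: "B \<in> Pow S"
    then have "insert a S - B = insert a (S - B)" "a \<notin> S - B" using assms(2) by auto
    then show "?w B * h B = (1 - x a) * ((\<Prod>i\<in>B. x i) * (\<Prod>j\<in>S - B. 1 - x j) * h B)"
      using assms(1) by simp
  qed
  also have "(\<Sum>B\<in>insert a ` Pow S. ?w B * h B) = x a * indep_expect S x (\<lambda>B. h (insert a B))"
    unfolding indep_expect_def sum_distrib_left sum.reindex[OF inj] o_def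
  proof (intro sum.cong refl)
    fix B assume B: "B \<in> Pow S"
    then have "insert a S - insert a B = S - B" "a \<notin> B" using assms(2) by auto
    then show "?w (insert a B) * h (insert a B) =
        x a * ((\<Prod>i\<in>B. x i) * (\<Prod>j\<in>S - B. 1 - x j) * h (insert a B))"
      using fin[OF B] by simp
  qed
  finally show ?thesis by simp
qed

lemma indep_expect_const:
  assumes "finite S"
  shows "indep_expect S x (\<lambda>_. c) = c"
  using assms
proof (induction S)
  case empty
  show ?case by (simp add: indep_expect_def)
next
  case (insert a S)
  then show ?case by (simp add: indep_expect_insert algebra_simps)
qed

lemma indep_expect_add:
  "indep_expect S x (\<lambda>B. g B + h B) = indep_expect S x g + indep_expect S x h"
  by (simp add: indep_expect_def distrib_left sum.distrib)

lemma indep_expect_sum: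
  "indep_expect S x (\<lambda>B. \<Sum>i\<in>I. h i B) = (\<Sum>i\<in>I. indep_expect S x (h i))"
  unfolding indep_expect_def sum_distrib_left by (rule sum.swap)

lemma indep_expect_cong:
  assumes "\<And>B. B \<subseteq> S \<Longrightarrow> g B = h B"
  shows "indep_expect S x g = indep_expect S x h"
  using assms by (simp add: indep_expect_def)

lemma indep_expect_mono:
  assumes x: "\<And>i. i \<in> S \<Longrightarrow> 0 \<le> x i \<and> x i \<le> 1"
    and le: "\<And>B. B \<subseteq> S \<Longrightarrow> g B \<le> h B"
  shows "indep_expect S x g \<le> indep_expect S x h"
  unfolding indep_expect_def
proof (intro sum_mono mult_left_mono)
  fix B assume B: "B \<in> Pow S"
  show "g B \<le> h B" using B le by simp
  show "0 \<le> (\<Prod>i\<in>B. x i) * (\<Prod>j\<in>S - B. 1 - x j)"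
    using B x by (intro mult_nonneg_nonneg prod_nonneg) auto
qed

text \<open>This is conditioning on the presence of \<open>a\<close>: only the branch containing
  \<open>a\<close> survives, leaving its probability times a conditional expectation over the
  remaining elements.\<close>

lemma indep_expect_insert_supported:
  assumes "finite S" "a \<notin> S" "\<And>B. B \<subseteq> S \<Longrightarrow> h B = 0"
  shows "indep_expect (insert a S) x h = x a * indep_expect S x (\<lambda>B. h (insert a B))"
proof -
  have "indep_expect S x h = indep_expect S x (\<lambda>_. 0)"
    by (intro indep_expect_cong assms)
  then show ?thesis using assms by (simp add: indep_expect_insert indep_expect_const)
qed

text \<open>Induction on the ground set. Conditioned on whether \<open>a\<close> is present, the
  induction hypothesis handles each of the two branches; what remains is Chebyshev's inequality for
  the two conditional means.\<close>

lemma harris_inequality: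
  assumes "finite S"
    and "\<And>i. i \<in> S \<Longrightarrow> 0 \<le> x i \<and> x i \<le> 1"
    and "\<And>A B. A \<subseteq> B \<Longrightarrow> B \<subseteq> S \<Longrightarrow> g B \<le> g A"
    and "\<And>A B. A \<subseteq> B \<Longrightarrow> B \<subseteq> S \<Longrightarrow> h B \<le> h A"
  shows "indep_expect S x g * indep_expect S x h \<le> indep_expect S x (\<lambda>B. g B * h B)"
  using assms
proof (induction S arbitrary: g h)
  case empty
  show ?case by (simp add: indep_expect_def)
next
  case (insert a S)
  note x = insert.prems(1) and g = insert.prems(2) and h = insert.prems(3)
  let ?E = "indep_expect S x"
  let ?g = "\<lambda>B. g (insert a B)" and ?h = "\<lambda>B. h (insert a B)"
  have xa: "0 \<le> x a" "0 \<le> 1 - x a" using x[of a] by auto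
  have IH0: "?E g * ?E h \<le> ?E (\<lambda>B. g B * h B)"
    by (rule insert.IH) (use x in auto, (intro g h; auto)+)
  have IH1: "?E ?g * ?E ?h \<le> ?E (\<lambda>B. ?g B * ?h B)"
    by (rule insert.IH) (use x in auto, (intro g h; auto)+)
  have "?E ?g \<le> ?E g" "?E ?h \<le> ?E h"
    by (intro indep_expect_mono x g h; auto)+
  \<comment> \<open>This product is the covariance of the two conditional means over the choice of
    \<open>a\<close>. It is nonnegative because inserting \<open>a\<close> lowers both
    means.\<close>
  then have "0 \<le> (x a * (1 - x a)) * ((?E g - ?E ?g) * (?E h - ?E ?h))"
    using xa by (intro mult_nonneg_nonneg) auto
  then have "(x a * ?E ?g + (1 - x a) * ?E g) * (x a * ?E ?h + (1 - x a) * ?E h)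
      \<le> x a * (?E ?g * ?E ?h) + (1 - x a) * (?E g * ?E h)"
    by (simp add: algebra_simps)
  also have "\<dots> \<le> x a * ?E (\<lambda>B. ?g B * ?h B) + (1 - x a) * ?E (\<lambda>B. g B * h B)"
    by (intro add_mono mult_left_mono IH0 IH1 xa)
  finally show ?case by (simp add: indep_expect_insert insert.hyps)
qed

text \<open>Only the part of \<open>B\<close> strictly below \<open>i\<close> enters, so the value
  does not depend on whether \<open>i\<close> lies in \<open>B\<close>. The gain is thus a function
  of the other elements, independent of the event that \<open>i\<close> is present.\<close>

definition prefix_gain :: "('a::linorder set \<Rightarrow> real) \<Rightarrow> 'a set \<Rightarrow> 'a \<Rightarrow> real" where
  "prefix_gain f B i = f (insert i (B \<inter> {..<i})) - f (B \<inter> {..<i})"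

lemma prefix_gain_insert [simp]: "prefix_gain f (insert i B) i = prefix_gain f B i"
  by (simp add: prefix_gain_def Int_insert_left)

text \<open>The sum telescopes. A new largest element \<open>b\<close> leaves the prefixes of the
  earlier elements unchanged, and its own prefix is all of \<open>A\<close>.\<close>

lemma sum_prefix_gain:
  assumes "finite B"
  shows "f B = f {} + (\<Sum>i\<in>B. prefix_gain f B i)"
  using assms
proof (induction rule: finite_linorder_max_induct)
  case empty
  show ?case by simp
next
  case (insert b A)
  have "b \<notin> A" and "A \<inter> {..<b} = A" using insert.hyps by auto
  then have gain_b: "prefix_gain f (insert b A) b = f (insert b A) - f A"
    by (simp add: prefix_gain_def)
  have "insert b A \<inter> {..<i} = A \<inter> {..<i}" if "i \<in> A" for i
    using insert.hyps(2) that by auto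
  then have "(\<Sum>i\<in>A. prefix_gain f (insert b A) i) = (\<Sum>i\<in>A. prefix_gain f A i)"
    by (intro sum.cong) (simp_all add: prefix_gain_def)
  with gain_b \<open>b \<notin> A\<close> insert show ?case by simp
qed

lemma prefix_gain_nonneg:
  assumes "monotone_setfun_on E f" "B \<subseteq> E" "i \<in> E"
  shows "0 \<le> prefix_gain f B i"
proof -
  have "insert i (B \<inter> {..<i}) \<subseteq> E" using assms by auto
  then show ?thesis
    using assms(1) unfolding monotone_setfun_on_def prefix_gain_def by (simp add: subset_insertI)
qed

lemma prefix_gain_antimono:
  assumes f: "submodular_on E f" and "A \<subseteq> B" "B \<subseteq> E" "i \<in> E"
  shows "prefix_gain f B i \<le> prefix_gain f A i"
proof -
  \<comment> \<open>Since \<open>i\<close> is not below itself, intersecting these sets drops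
    \<open>i\<close> and leaves the prefix of \<open>A\<close>, so submodularity of this pair
    compares exactly the two gains.\<close>
  let ?S = "insert i (A \<inter> {..<i})" and ?T = "B \<inter> {..<i}"
  have "?S \<union> ?T = insert i ?T" "?S \<inter> ?T = A \<inter> {..<i}" using \<open>A \<subseteq> B\<close> by auto
  moreover have "f (?S \<union> ?T) + f (?S \<inter> ?T) \<le> f ?S + f ?T"
  proof -
    have "?S \<subseteq> E" "?T \<subseteq> E" using assms by auto
    then show ?thesis using f unfolding submodular_on_def by blast
  qed
  ultimately show ?thesis by (simp add: prefix_gain_def)
qed

theorem theorem5:
  fixes n :: nat and x :: "nat \<Rightarrow> real" and \<beta> :: real
    and q :: "nat set \<Rightarrow> nat set \<Rightarrow> real" and f :: "nat set \<Rightarrow> real"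
  assumes x: "\<And>i. i \<in> {1..n} \<Longrightarrow> 0 \<le> x i \<and> x i \<le> 1"
    and q_nonneg: "\<And>B A. B \<subseteq> {1..n} \<Longrightarrow> A \<subseteq> B \<Longrightarrow> 0 \<le> q B A"
    and q_sum: "\<And>B. B \<subseteq> {1..n} \<Longrightarrow> (\<Sum>A\<in>Pow B. q B A) = 1"
    and beta: "0 \<le> \<beta>"
    and marginal: "\<And>i. i \<in> {1..n} \<Longrightarrow>
      (\<Sum>B\<in>Pow {1..n}. indep_prob n x B * (\<Sum>A\<in>{A. A \<subseteq> B \<and> i \<in> A}. q B A))
        \<ge> \<beta> * (\<Sum>B\<in>{B. B \<subseteq> {1..n} \<and> i \<in> B}. indep_prob n x B)"
    and monotonicity: "\<And>B B' i. B \<subseteq> B' \<Longrightarrow> B' \<subseteq> {1..n} \<Longrightarrow> i \<in> B \<Longrightarrow>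
      (\<Sum>A\<in>{A. A \<subseteq> B \<and> i \<in> A}. q B A) \<ge> (\<Sum>A'\<in>{A'. A' \<subseteq> B' \<and> i \<in> A'}. q B' A')"
    and f_nonneg: "\<And>S. S \<subseteq> {1..n} \<Longrightarrow> 0 \<le> f S"
    and f_mono: "monotone_setfun_on {1..n} f"
    and f_submod: "submodular_on {1..n} f"
    and degenerate: "(\<forall>i\<in>{1..n}. x i = 0) \<Longrightarrow> \<beta> \<le> 1 \<or> f {} = 0"
  shows "(\<Sum>B\<in>Pow {1..n}. indep_prob n x B * (\<Sum>A\<in>Pow B. q B A * f A))
      \<ge> \<beta> * (\<Sum>B\<in>Pow {1..n}. indep_prob n x B * f B)"
proof -
  let ?N = "{1..n}"
  let ?E = "indep_expect ?N x"
  define m where "m B i = (\<Sum>A\<in>{A. A \<subseteq> B \<and> i \<in> A}. q B A)" for B i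
  let ?d = "prefix_gain f"
  have E_eq: "(\<Sum>B\<in>Pow ?N. indep_prob n x B * h B) = ?E h" for h
    by (simp add: indep_expect_def indep_prob_def)
  have fin: "finite B" if "B \<subseteq> ?N" for B
    using that finite_subset by auto
  have m_outside: "m B i = 0" if "i \<notin> B" for B i
  proof -
    have "{A. A \<subseteq> B \<and> i \<in> A} = {}" using that by auto
    then show ?thesis unfolding m_def by (simp only: sum.empty)
  qed
  have m_le_1: "m B i \<le> 1" if "B \<subseteq> ?N" for B i
  proof -
    have "m B i \<le> (\<Sum>A\<in>Pow B. q B A)"
      unfolding m_def using that fin q_nonneg by (intro sum_mono2) auto
    then show ?thesis using q_sum that by simp
  qed

  \<comment> \<open>The marginal property in conditional form: both sides carry the probability
    \<open>x i\<close> that \<open>i\<close> is present. The factor is kept because it may be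
    zero.\<close>
  have marg: "\<beta> * x i \<le> x i * indep_expect (?N - {i}) x (\<lambda>B. m (insert i B) i)"
    if i: "i \<in> ?N" for i
  proof -
    let ?S = "?N - {i}"
    have N: "?N = insert i ?S" using i by auto
    have "(\<Sum>B\<in>{B. B \<subseteq> ?N \<and> i \<in> B}. indep_prob n x B) = ?E (\<lambda>B. of_bool (i \<in> B))"
      unfolding E_eq[symmetric] by (rule sum.mono_neutral_cong_left) auto
    also have "\<dots> = x i"
      by (subst N, subst indep_expect_insert_supported) (auto simp: indep_expect_const)
    finally have "\<beta> * x i \<le> ?E (\<lambda>B. m B i)"
      using marginal[OF i] unfolding m_def[symmetric] E_eq by simp
    also have "\<dots> = x i * indep_expect ?S x (\<lambda>B. m (insert i B) i)"
      by (subst N, subst indep_expect_insert_supported) (auto intro: m_outside)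
    finally show ?thesis .
  qed

  have key: "\<beta> * ?E (\<lambda>B. of_bool (i \<in> B) * ?d B i) \<le> ?E (\<lambda>B. m B i * ?d B i)"
    if i: "i \<in> ?N" for i
  proof -
    let ?S = "?N - {i}"
    let ?ES = "indep_expect ?S x"
    have N: "?N = insert i ?S" using i by auto
    have xS: "\<And>j. j \<in> ?S \<Longrightarrow> 0 \<le> x j \<and> x j \<le> 1" using x by auto
    have "?ES (\<lambda>_. 0) \<le> ?ES (\<lambda>B. ?d B i)"
      using i by (intro indep_expect_mono[OF xS] prefix_gain_nonneg[OF f_mono]) auto
    then have d_nonneg: "0 \<le> ?ES (\<lambda>B. ?d B i)" by (simp add: indep_expect_const)
    \<comment> \<open>Monotonicity compares only sets that contain \<open>i\<close>. Hence Harris is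
      applied on the ground set without \<open>i\<close>, with \<open>i\<close> inserted into the
      argument of \<open>m\<close>.\<close>
    have harris: "?ES (\<lambda>B. m (insert i B) i) * ?ES (\<lambda>B. ?d B i)
        \<le> ?ES (\<lambda>B. m (insert i B) i * ?d B i)"
    proof (rule harris_inequality)
      fix A B assume AB: "A \<subseteq> B" "B \<subseteq> ?S"
      show "m (insert i B) i \<le> m (insert i A) i"
        unfolding m_def using AB i by (intro monotonicity) auto
      show "?d B i \<le> ?d A i"
        using AB i by (intro prefix_gain_antimono[OF f_submod]) auto
    qed (use xS in auto)
    have "\<beta> * ?E (\<lambda>B. of_bool (i \<in> B) * ?d B i) = \<beta> * x i * ?ES (\<lambda>B. ?d B i)"
      by (subst N, subst indep_expect_insert_supported) auto
    \<comment> \<open>Multiplying the marginal bound by the mean gain keeps its direction because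
      monotonicity of \<open>f\<close> makes gains nonnegative.\<close>
    also have "\<dots> \<le> x i * ?ES (\<lambda>B. m (insert i B) i) * ?ES (\<lambda>B. ?d B i)"
      by (intro mult_right_mono marg i d_nonneg)
    also have "\<dots> \<le> x i * ?ES (\<lambda>B. m (insert i B) i * ?d B i)"
      using harris x[OF i] by (simp add: mult.assoc mult_left_mono)
    also have "\<dots> = ?E (\<lambda>B. m B i * ?d B i)"
      by (subst (2) N, subst indep_expect_insert_supported) (auto intro: m_outside)
    finally show ?thesis .
  qed

  have selected: "f {} + (\<Sum>i\<in>?N. m B i * ?d B i) \<le> (\<Sum>A\<in>Pow B. q B A * f A)"
    if B: "B \<subseteq> ?N" for B
  proof -
    have "(\<Sum>i\<in>?N. m B i * ?d B i)
        = (\<Sum>i\<in>?N. \<Sum>A\<in>Pow B. q B A * (of_bool (i \<in> A) * ?d B i))"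
    proof (intro sum.cong refl)
      fix i
      have "m B i = (\<Sum>A\<in>Pow B. q B A * of_bool (i \<in> A))"
        unfolding m_def using fin[OF B] by (intro sum.mono_neutral_cong_left) auto
      then show "m B i * ?d B i = (\<Sum>A\<in>Pow B. q B A * (of_bool (i \<in> A) * ?d B i))"
        by (simp add: sum_distrib_right mult.assoc)
    qed
    also have "\<dots> = (\<Sum>A\<in>Pow B. q B A * (\<Sum>i\<in>?N. of_bool (i \<in> A) * ?d B i))"
      unfolding sum_distrib_left by (rule sum.swap)
    \<comment> \<open>As \<open>q B\<close> has total mass 1, the constant \<open>f {}\<close> moves
      inside the average over \<open>A\<close>, and the bound can be checked for each
      \<open>A\<close> separately.\<close>
    finally have "f {} + (\<Sum>i\<in>?N. m B i * ?d B i)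
        = (\<Sum>A\<in>Pow B. q B A * (f {} + (\<Sum>i\<in>?N. of_bool (i \<in> A) * ?d B i)))"
      using q_sum[OF B] by (simp add: distrib_left sum.distrib flip: sum_distrib_right)
    also have "\<dots> \<le> (\<Sum>A\<in>Pow B. q B A * f A)"
    proof (intro sum_mono mult_left_mono)
      fix A assume "A \<in> Pow B"
      then have A: "A \<subseteq> B" "A \<subseteq> ?N" using B by auto
      have "(\<Sum>i\<in>?N. of_bool (i \<in> A) * ?d B i) = (\<Sum>i\<in>A. ?d B i)"
        using A by (intro sum.mono_neutral_cong_right) auto
      also have "\<dots> \<le> (\<Sum>i\<in>A. ?d A i)"
        using A B by (intro sum_mono prefix_gain_antimono[OF f_submod]) auto
      finally show "f {} + (\<Sum>i\<in>?N. of_bool (i \<in> A) * ?d B i) \<le> f A"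
        using sum_prefix_gain[OF fin[OF A(2)], of f] by simp
      show "0 \<le> q B A" using q_nonneg A B by simp
    qed
    finally show ?thesis .
  qed

  \<comment> \<open>If some \<open>x i\<close> is positive, \<open>marg\<close> bounds \<beta> by a
    mean of selection probabilities, so \<beta> is at most 1. Otherwise \<beta> > 1 is possible only
    with all \<open>x i\<close> zero, where \<open>degenerate\<close> gives
    \<open>f {} = 0\<close>.\<close>
  have beta_f: "\<beta> * f {} \<le> f {}"
  proof (cases "\<beta> \<le> 1")
    case True
    then show ?thesis using f_nonneg[of "{}"] mult_right_mono[of \<beta> 1 "f {}"] by simp
  next
    case False
    have "x i = 0" if i: "i \<in> ?N" for i
    proof (rule ccontr)
      assume "x i \<noteq> 0"
      then have "0 < x i" using x[OF i] by simp
      then have "\<beta> \<le> indep_expect (?N - {i}) x (\<lambda>B. m (insert i B) i)"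
        using marg[OF i] by (simp add: mult.commute)
      also have "\<dots> \<le> indep_expect (?N - {i}) x (\<lambda>_. 1)"
        using x i by (intro indep_expect_mono m_le_1) auto
      finally show False using False by (simp add: indep_expect_const)
    qed
    then show ?thesis using degenerate False by simp
  qed

  \<comment> \<open>The indicators make the sum range over the fixed set \<open>{1..n}\<close>
    instead of \<open>B\<close>, so that it can be exchanged with the expectation and bounded term
    by term through \<open>key\<close>.\<close>
  have "?E f = ?E (\<lambda>B. f {} + (\<Sum>i\<in>?N. of_bool (i \<in> B) * ?d B i))"
  proof (rule indep_expect_cong)
    fix B assume B: "B \<subseteq> ?N"
    have "(\<Sum>i\<in>?N. of_bool (i \<in> B) * ?d B i) = (\<Sum>i\<in>B. ?d B i)"
      using B by (intro sum.mono_neutral_cong_right) auto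
    then show "f B = f {} + (\<Sum>i\<in>?N. of_bool (i \<in> B) * ?d B i)"
      using sum_prefix_gain[OF fin[OF B]] by simp
  qed
  then have "\<beta> * ?E f = \<beta> * f {} + (\<Sum>i\<in>?N. \<beta> * ?E (\<lambda>B. of_bool (i \<in> B) * ?d B i))"
    by (simp only: indep_expect_add indep_expect_sum indep_expect_const distrib_left
        sum_distrib_left finite_atLeastAtMost)
  also have "\<dots> \<le> f {} + (\<Sum>i\<in>?N. ?E (\<lambda>B. m B i * ?d B i))"
    by (intro add_mono beta_f sum_mono key)
  also have "\<dots> = ?E (\<lambda>B. f {} + (\<Sum>i\<in>?N. m B i * ?d B i))"
    by (simp add: indep_expect_add indep_expect_sum indep_expect_const)
  also have "\<dots> \<le> ?E (\<lambda>B. \<Sum>A\<in>Pow B. q B A * f A)"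
    by (intro indep_expect_mono x selected) auto
  finally show ?thesis unfolding E_eq .
qed

end
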